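(* Let $c\in(0,1/10]$ and $\kappa\ge2$, and let $y_0=y_0(c,\kappa)$ be a sufficiently large number in terms of $c,\kappa$. For $y>y_0$ and $\delta\in(0,1]$, put $\lambda=2\delta\log\log y$ and $v=\big\lfloor\frac{1}{\log 2}\log\log y\big\rfloor$. Then for $y>y_0$ one has, uniformly for $\delta\in[c,1]$, $$\sum_{1\le k\le v}\frac{\lambda^k}{k!}\cdot\frac{v-k+1}{v}\asymp_c\begin{cases}e^{\lambda}\max\Big\{\frac{1}{\log 4}-\delta,\ \frac{1}{\sqrt{\log\log y}}\Big\}, & \text{if }\delta\le\frac{1}{\log 4},\\[8pt] \dfrac{\lambda^v}{v!}\cdot\dfrac{1}{\max\Big\{\big(\delta-\frac{1}{\log 4}\big)^2\log\log y,\ 1\Big\}}, & \text{if }\delta>\frac{1}{\log 4}.\end{cases}$$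
   Context: The notation $A\asymp_{c}B$ means that $C_1B\le A\le C_2B$ for positive constants $C_1,C_2$ depending only on $c$. *)

theory Defs
  imports Complex_Main
begin

definition lam :: "real \<Rightarrow> real \<Rightarrow> real" where
  "lam \<delta> y = 2 * \<delta> * ln (ln y)"

text \<open>The floor is taken as a natural number; it is nonnegative as soon as
  \<open>ln (ln y) \<ge> 0\<close>, in particular for all sufficiently large \<open>y\<close>.\<close>

definition vv :: "real \<Rightarrow> nat" where
  "vv y = nat \<lfloor>ln (ln y) / ln 2\<rfloor>"

definition weighted_sum :: "real \<Rightarrow> real \<Rightarrow> real" where
  "weighted_sum \<delta> y =
     (\<Sum>k=1..vv y. lam \<delta> y ^ k / fact k * ((real (vv y) - real k + 1) / real (vv y)))"

definition size_bound :: "real \<Rightarrow> real \<Rightarrow> real" where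
  "size_bound \<delta> y =
     (if \<delta> \<le> 1 / ln 4
      then exp (lam \<delta> y) * max (1 / ln 4 - \<delta>) (1 / sqrt (ln (ln y)))
      else lam \<delta> y ^ vv y / fact (vv y) * (1 / max ((\<delta> - 1 / ln 4)\<^sup>2 * ln (ln y)) 1))"

end

theory Submission imports Defs "HOL-Analysis.Harmonic_Numbers" begin

text \<open>
  Up to the factor \<open>v\<close> and the term \<open>k = 0\<close>, the sum in question is
  \<open>F = (\<Sum>k\<le>v. (v + 1 - k) t\<^sub>k)\<close> with \<open>t\<^sub>k = \<lambda>^k / k!\<close>, that is, \<open>e^\<lambda>\<close> times the expectation of
  \<open>max (v + 1 - X) 0\<close> for a Poisson variable \<open>X\<close> of mean \<open>\<lambda>\<close>. Write \<open>L = ln (ln y)\<close>. The threshold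
  \<open>\<delta> = 1 / ln 4\<close> is where the mean \<open>\<lambda> = 2 \<delta> L\<close> crosses \<open>2 L / ln 4 = L / ln 2\<close>, whose integer part
  is \<open>v\<close>. Since \<open>k t\<^sub>k = \<lambda> t\<^sub>k\<^sub>-\<^sub>1\<close>, the sum telescopes to
  \<open>F = (v + 1 - \<lambda>) (\<Sum>k\<le>v. t\<^sub>k) + \<lambda> t\<^sub>v\<close> (\<open>deficit_sum_eq\<close>), and this identity carries most of the
  proof.

  Mean below \<open>v + 1\<close>. The identity gives \<open>F \<le> (v + 1 - \<lambda>) e^\<lambda> + \<lambda> t\<^sub>v\<close>, where \<open>t\<^sub>v\<close> is at most a
  constant times \<open>e^\<lambda> / sqrt \<lambda>\<close> because about \<open>sqrt \<lambda>\<close> of the terms preceding \<open>t\<^sub>v\<close> are of comparable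
  size (\<open>weight_before_top\<close>). From below, \<open>F \<ge> (v + 1 - \<lambda>) e^\<lambda>\<close> since an expectation is at most
  the expectation of the positive part; and \<open>F\<close> is at least the same sum with \<open>v\<close> replaced by the
  integer part \<open>m\<close> of \<open>\<lambda>\<close>, which by the identity is at least \<open>\<lambda> t\<^sub>m\<close>. Chebyshev's inequality puts
  most of the mass on about \<open>sqrt \<lambda>\<close> integers, so the largest weight \<open>t\<^sub>m\<close> is at least a constant
  times \<open>e^\<lambda> / sqrt \<lambda>\<close> (\<open>mode_weight_ge\<close>).

  Mean above \<open>v\<close>. Going down from \<open>k = v\<close>, the weights decay at least as fast as the powers of
  \<open>v / \<lambda>\<close>, which gives \<open>F \<le> t\<^sub>v (\<lambda> / (\<lambda> - v))\<^sup>2\<close>, while the identity gives \<open>F \<le> (v + 1 + \<lambda>) t\<^sub>v\<close>; the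
  smaller of the two bounds is the claimed order. Conversely the \<open>j\<close>-th weight below the top is at
  least \<open>t\<^sub>v / 2\<close> as long as \<open>j\<close> is at most a small multiple of
  \<open>min (sqrt \<lambda>) (\<lambda> / (\<lambda> - v + 1))\<close>, and summing \<open>j + 1\<close> over that range recovers the same order.
\<close>

section \<open>Poisson weights\<close>

definition weight :: "real \<Rightarrow> nat \<Rightarrow> real" where
  "weight l k = l ^ k / fact k"

lemma weight_nonneg: "0 \<le> l \<Longrightarrow> 0 \<le> weight l k"
  by (simp add: weight_def)

lemma weight_Suc: "real (Suc k) * weight l (Suc k) = l * weight l k"
  by (simp add: weight_def field_simps del: of_nat_Suc)

lemma weight_sums: "weight l sums exp l"
  using exp_converges[of l] by (simp add: weight_def[abs_def] scaleR_conv_of_real field_simps)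

lemma weight_first_moment: "(\<lambda>k. real k * weight l k) sums (l * exp l)"
proof -
  have "(\<lambda>k. real (Suc k) * weight l (Suc k)) sums (l * exp l)"
    unfolding weight_Suc by (intro sums_mult weight_sums)
  then show ?thesis
    by (subst (asm) sums_Suc_iff) simp
qed

lemma weight_second_moment: "(\<lambda>k. (real k)\<^sup>2 * weight l k) sums ((l\<^sup>2 + l) * exp l)"
proof -
  have eq: "(real (Suc k))\<^sup>2 * weight l (Suc k) = l * (real k * weight l k + weight l k)" for k
  proof -
    have "(real (Suc k))\<^sup>2 * weight l (Suc k) = real (Suc k) * (real (Suc k) * weight l (Suc k))"
      by (simp only: power2_eq_square mult.assoc)
    also have "\<dots> = real (Suc k) * (l * weight l k)"
      by (simp only: weight_Suc)
    finally show ?thesis by (simp add: algebra_simps)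
  qed
  have "(\<lambda>k. l * (real k * weight l k + weight l k)) sums (l * (l * exp l + exp l))"
    by (intro sums_mult sums_add weight_first_moment weight_sums)
  then have "(\<lambda>k. (real (Suc k))\<^sup>2 * weight l (Suc k)) sums (l * (l * exp l + exp l))"
    unfolding eq .
  then show ?thesis
    by (subst (asm) sums_Suc_iff) (simp add: power2_eq_square algebra_simps)
qed

lemma weight_variance: "(\<lambda>k. (real k - l)\<^sup>2 * weight l k) sums (l * exp l)"
proof -
  have "(\<lambda>k. (real k)\<^sup>2 * weight l k - 2 * l * (real k * weight l k) + l\<^sup>2 * weight l k)
     sums ((l\<^sup>2 + l) * exp l - 2 * l * (l * exp l) + l\<^sup>2 * exp l)"
    by (intro sums_add sums_diff sums_mult weight_first_moment weight_second_moment weight_sums)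
  then show ?thesis
    by (simp add: power2_eq_square algebra_simps)
qed

lemma sum_weight_le_exp: "0 \<le> l \<Longrightarrow> (\<Sum>k\<in>K. weight l k) \<le> exp l"
proof (cases "finite K")
  case True
  assume "0 \<le> l"
  with True have "sum (weight l) K \<le> suminf (weight l)"
    by (intro sum_le_suminf sums_summable[OF weight_sums]) (auto simp: weight_nonneg)
  then show ?thesis
    by (simp add: sums_unique[OF weight_sums, symmetric])
qed simp

lemma weight_mono_below:
  assumes "0 \<le> l" "j \<le> k" "real k \<le> l"
  shows "weight l j \<le> weight l k"
  using assms(2,3)
proof (induction k rule: dec_induct)
  case (step n)
  have "real (Suc n) * weight l n \<le> l * weight l n"
    using step assms(1) by (intro mult_right_mono weight_nonneg) auto
  also have "\<dots> = real (Suc n) * weight l (Suc n)"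
    by (simp only: weight_Suc)
  finally have "weight l n \<le> weight l (Suc n)"
    by (subst (asm) mult_le_cancel_left_pos) auto
  with step show ?case by auto
qed simp

lemma weight_antimono_above:
  assumes "0 \<le> l" "j \<le> k" "l \<le> real j + 1"
  shows "weight l k \<le> weight l j"
  using assms(2)
proof (induction k rule: dec_induct)
  case (step n)
  have "real (Suc n) * weight l (Suc n) = l * weight l n"
    by (simp only: weight_Suc)
  also have "\<dots> \<le> real (Suc n) * weight l n"
    using step assms by (intro mult_right_mono weight_nonneg) auto
  finally have "weight l (Suc n) \<le> weight l n"
    by (subst (asm) mult_le_cancel_left_pos) auto
  with step show ?case by auto
qed simp

lemma weight_le_mode:
  assumes "0 \<le> l" "real m \<le> l" "l \<le> real m + 1"
  shows "weight l k \<le> weight l m"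
  using assms weight_mono_below[of l k m] weight_antimono_above[of l m k]
  by (cases "k \<le> m") auto

text \<open>
  Chebyshev's inequality: the variance is \<open>l\<close>, so three quarters of the mass \<open>exp l\<close> lies within
  \<open>2 * sqrt l\<close> of the mean. That window contains at most \<open>5 * sqrt l\<close> integers, none of which
  outweighs the mode.
\<close>

lemma mode_weight_ge:
  assumes "1 \<le> l" "real m \<le> l" "l \<le> real m + 1"
  shows "3 / 20 * exp l \<le> sqrt l * weight l m"
proof -
  define g where "g k = weight l k - 1 / (4 * l) * ((real k - l)\<^sup>2 * weight l k)" for k
  define a where "a = nat \<lceil>l - 2 * sqrt l\<rceil>"
  define b where "b = nat \<lfloor>l + 2 * sqrt l\<rfloor>"
  have s: "1 \<le> sqrt l" "sqrt l * sqrt l = l"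
    using assms by auto
  have g_sums: "g sums (exp l - 1 / (4 * l) * (l * exp l))"
    unfolding g_def[abs_def] by (intro sums_diff sums_mult weight_variance weight_sums)
  have a_ge: "l - 2 * sqrt l \<le> real a" unfolding a_def by linarith
  have b_le: "real b \<le> l + 2 * sqrt l" unfolding b_def using assms s by linarith
  have out: "g k \<le> 0" if "k \<notin> {a..b}" for k
  proof -
    have "2 * sqrt l \<le> \<bar>real k - l\<bar>"
    proof (cases "k < a")
      case True
      then have "real k \<le> l - 2 * sqrt l" unfolding a_def by linarith
      then show ?thesis by linarith
    next
      case False
      with that have "b < k" by auto
      then have "l + 2 * sqrt l \<le> real k" unfolding b_def by linarith
      then show ?thesis by linarith
    qed
    then have "(2 * sqrt l)\<^sup>2 \<le> \<bar>real k - l\<bar>\<^sup>2"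
      using s by (intro power_mono) auto
    then have "4 * l \<le> (real k - l)\<^sup>2"
      using assms by (simp add: power_mult_distrib)
    then have "1 \<le> 1 / (4 * l) * (real k - l)\<^sup>2"
      using assms by (simp add: field_simps)
    then have "1 * weight l k \<le> 1 / (4 * l) * (real k - l)\<^sup>2 * weight l k"
      using assms by (intro mult_right_mono weight_nonneg) auto
    then show ?thesis by (simp add: g_def)
  qed
  have "3 / 4 * exp l = suminf g"
    using sums_unique[OF g_sums] assms by (simp add: field_simps)
  also have "\<dots> \<le> sum g {a..b}"
  proof -
    have "sum (\<lambda>k. - g k) {a..b} \<le> suminf (\<lambda>k. - g k)"
      using out sums_summable[OF sums_minus[OF g_sums]] by (intro sum_le_suminf) auto
    then show ?thesis
      by (simp add: sum_negf suminf_minus[OF sums_summable[OF g_sums]])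
  qed
  also have "\<dots> \<le> (\<Sum>k\<in>{a..b}. weight l m)"
  proof (rule sum_mono)
    fix k
    have "g k \<le> weight l k"
      using assms weight_nonneg[of l k] by (simp add: g_def)
    also have "\<dots> \<le> weight l m"
      using assms by (intro weight_le_mode) auto
    finally show "g k \<le> weight l m" .
  qed
  also have "\<dots> = real (card {a..b}) * weight l m" by simp
  also have "\<dots> \<le> (5 * sqrt l) * weight l m"
  proof (intro mult_right_mono weight_nonneg)
    have "real (card {a..b}) \<le> max 0 (real b + 1 - real a)"
      by (cases "a \<le> Suc b") (auto simp: of_nat_diff)
    then show "real (card {a..b}) \<le> 5 * sqrt l"
      using a_ge b_le s by linarith
  qed (use assms in auto)
  finally show ?thesis by simp
qed

section \<open>Weights just below a given index\<close>

lemma weight_step_down: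
  assumes "0 < l" "Suc j \<le> v"
  shows "weight l (v - Suc j) = weight l (v - j) * ((real v - real j) / l)"
proof -
  have eq: "v - j = Suc (v - Suc j)" using assms by simp
  have "real (v - j) * weight l (v - j) = l * weight l (v - Suc j)"
    unfolding eq by (rule weight_Suc)
  then show ?thesis using assms by (simp add: field_simps of_nat_diff)
qed

text \<open>
  The ratio to the weight at \<open>v\<close> is the product of the \<open>j\<close> factors \<open>1 - (l - v + i) / l\<close> with
  \<open>i < j\<close>; expanding the product to first order gives a lower bound.
\<close>

lemma weight_down_ge:
  assumes "0 < l" "j \<le> v"
  shows "weight l v * (1 - real j * (l - real v + real j) / l) \<le> weight l (v - j)"
  using assms(2)
proof (induction j)
  case (Suc j)
  define a where "a = l - real v"
  define x where "x = real j * (a + real j) / l"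
  define z where "z = (a + real j) / l"
  have w: "0 \<le> weight l v" using assms by (simp add: weight_nonneg)
  have z: "1 - z = (real v - real j) / l" "0 \<le> 1 - z"
    using assms Suc.prems by (auto simp: z_def a_def field_simps)
  have "x * z = real j * z\<^sup>2"
    by (simp add: x_def z_def power2_eq_square)
  then have xz: "0 \<le> x * z" by simp
  have "real (Suc j) * (l - real v + real (Suc j)) / l = x + z + (real j + 1) / l"
    using assms(1) by (simp add: x_def z_def a_def add_divide_distrib[symmetric] algebra_simps)
  then have "1 - real (Suc j) * (l - real v + real (Suc j)) / l \<le> 1 - x - z"
    using assms(1) by simp
  also have "\<dots> \<le> (1 - x) * (1 - z)"
    using xz by (simp add: algebra_simps)
  finally have "weight l v * (1 - real (Suc j) * (l - real v + real (Suc j)) / l)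
      \<le> weight l v * ((1 - x) * (1 - z))"
    using w by (rule mult_left_mono)
  also have "\<dots> = weight l v * (1 - x) * (1 - z)" by simp
  also have "\<dots> \<le> weight l (v - j) * (1 - z)"
    using Suc z by (intro mult_right_mono) (auto simp: x_def a_def)
  also have "\<dots> = weight l (v - Suc j)"
    using weight_step_down[OF assms(1) Suc.prems] z by simp
  finally show ?case .
qed simp

lemma weight_down_le:
  assumes "0 < l" "j \<le> v"
  shows "weight l (v - j) \<le> weight l v * (real v / l) ^ j"
  using assms(2)
proof (induction j)
  case (Suc j)
  have "weight l (v - Suc j) = weight l (v - j) * ((real v - real j) / l)"
    using weight_step_down[OF assms(1) Suc.prems] .
  also have "\<dots> \<le> weight l (v - j) * (real v / l)"
    using assms by (intro mult_left_mono weight_nonneg divide_right_mono) auto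
  also have "\<dots> \<le> weight l v * (real v / l) ^ j * (real v / l)"
    using Suc assms by (intro mult_right_mono) auto
  finally show ?case by (simp add: mult_ac)
qed simp

text \<open>
  Before index \<open>v\<close> there is a run of weights at least half as large as the one at \<open>v\<close>. Its length has the
  order of \<open>sqrt l\<close>, the standard deviation, or of \<open>l / A\<close>, the scale of the geometric decay caused
  by a mean exceeding \<open>v\<close> by \<open>A\<close>, whichever is shorter. The factor \<open>1 / 3\<close> makes the first-order loss at most
  \<open>1 / 3 + 1 / 9 < 1 / 2\<close>.
\<close>

lemma weight_before_top:
  assumes "1 \<le> l" "l \<le> 3 * real v" "1 \<le> A" "l \<le> real v + A"
    and j: "real j \<le> min (sqrt l) (l / A) / 3"
  shows "j \<le> v" and "weight l v / 2 \<le> weight l (v - j)"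
proof -
  have "1 \<le> v" using assms by (cases v) auto
  have js: "real j \<le> sqrt l / 3" and jA: "real j \<le> l / A / 3"
    using j by auto
  have s: "1 \<le> sqrt l" "sqrt l * sqrt l = l" using assms by auto
  have "sqrt l * 1 \<le> sqrt l * sqrt l" using s by (intro mult_left_mono) auto
  with s assms js show jv: "j \<le> v" by linarith
  have "real j * real j \<le> (sqrt l / 3) * (sqrt l / 3)"
    using js assms by (intro mult_mono) auto
  then have jj: "real j * real j \<le> l / 9" using s by simp
  have "real j * A \<le> l / 3" using jA assms by (simp add: field_simps)
  moreover have "real j * (l - real v) \<le> real j * A"
    using assms by (intro mult_left_mono) auto
  ultimately have "real j * (l - real v + real j) \<le> l / 2"
    using jj assms by (simp add: distrib_left)
  then have "real j * (l - real v + real j) / l \<le> 1 / 2"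
    using assms by (simp add: field_simps)
  then have "weight l v * (1 / 2)
      \<le> weight l v * (1 - real j * (l - real v + real j) / l)"
    using assms by (intro mult_left_mono weight_nonneg) auto
  also have "\<dots> \<le> weight l (v - j)"
    using assms jv by (intro weight_down_ge) auto
  finally show "weight l v / 2 \<le> weight l (v - j)" by simp
qed

section \<open>The expected deficit\<close>

definition deficit_sum :: "real \<Rightarrow> nat \<Rightarrow> real" where
  "deficit_sum l v = (\<Sum>k\<le>v. (real v - real k + 1) * weight l k)"

lemma deficit_sum_Suc:
  "deficit_sum l (Suc v) = deficit_sum l v + (\<Sum>k\<le>Suc v. weight l k)"
  unfolding deficit_sum_def
  by (simp add: sum.distrib[symmetric] algebra_simps)

lemma deficit_sum_mono:
  assumes "0 \<le> l" "m \<le> v"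
  shows "deficit_sum l m \<le> deficit_sum l v"
  using assms(2)
proof (induction v rule: dec_induct)
  case (step n)
  have "0 \<le> (\<Sum>k\<le>Suc n. weight l k)"
    using assms(1) by (intro sum_nonneg weight_nonneg)
  with step show ?case by (simp only: deficit_sum_Suc)
qed simp

lemma deficit_sum_eq:
  "deficit_sum l v = (real v + 1 - l) * (\<Sum>k\<le>v. weight l k) + l * weight l v"
proof (induction v)
  case (Suc v)
  have "l * weight l v = (real v + 1) * weight l (Suc v)"
    using weight_Suc[of v l] by (simp add: add.commute)
  with Suc show ?case
    by (simp add: deficit_sum_Suc algebra_simps)
qed (simp add: deficit_sum_def weight_def)

lemma deficit_sum_rev:
  "deficit_sum l v = (\<Sum>j\<le>v. (real j + 1) * weight l (v - j))"
  unfolding deficit_sum_def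
  by (rule sum.reindex_bij_witness[of _ "\<lambda>j. v - j" "\<lambda>j. v - j"]) (auto simp: of_nat_diff)

text \<open>
  Dropping the term \<open>k = 0\<close> is harmless as soon as \<open>l \<ge> 1\<close>: that term, \<open>v + 1\<close>, is at most twice
  the next one, \<open>v * l\<close>.
\<close>

lemma deficit_sum_from_1:
  assumes "1 \<le> l" "1 \<le> v"
  defines "G \<equiv> (\<Sum>k=1..v. (real v - real k + 1) * weight l k)"
  shows "G \<le> deficit_sum l v" and "deficit_sum l v \<le> 3 * G"
proof -
  have eq: "deficit_sum l v = real v + 1 + G"
    unfolding deficit_sum_def G_def atMost_atLeast0
    by (subst sum.atLeast_Suc_atMost) (auto simp: weight_def)
  then show "G \<le> deficit_sum l v" by simp
  have "real v * l = (\<Sum>k\<in>{1}. (real v - real k + 1) * weight l k)"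
    by (simp add: weight_def)
  also have "\<dots> \<le> G"
    unfolding G_def using assms
    by (intro sum_mono2 mult_nonneg_nonneg weight_nonneg) auto
  finally have "real v * l \<le> G" .
  moreover have "real v * 1 \<le> real v * l"
    using assms by (intro mult_left_mono) auto
  moreover have "1 \<le> real v" using assms by simp
  ultimately show "deficit_sum l v \<le> 3 * G" using eq by linarith
qed

section \<open>Mean below the cut-off\<close>

text \<open>The terms omitted from the full series for the expectation of \<open>v + 1 - X\<close> are nonpositive.\<close>

lemma deficit_sum_ge_mean_gap:
  assumes "0 \<le> l"
  shows "(real v + 1 - l) * exp l \<le> deficit_sum l v"
proof -
  define g where "g k = real k * weight l k - (real v + 1) * weight l k" for k
  have g_sums: "g sums (l * exp l - (real v + 1) * exp l)"
    unfolding g_def[abs_def] by (intro sums_diff sums_mult weight_first_moment weight_sums)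
  have "sum g {..v} \<le> suminf g"
  proof (intro sum_le_suminf sums_summable[OF g_sums])
    fix k assume "k \<in> - {..v}"
    then have "0 \<le> (real k - (real v + 1)) * weight l k"
      using assms by (intro mult_nonneg_nonneg weight_nonneg) auto
    then show "0 \<le> g k" by (simp add: g_def algebra_simps)
  qed simp
  moreover have "sum g {..v} = - deficit_sum l v"
    unfolding deficit_sum_def g_def by (simp add: sum_negf[symmetric] algebra_simps)
  ultimately show ?thesis
    using sums_unique[OF g_sums] by (simp add: algebra_simps)
qed

lemma deficit_sum_ge_sqrt:
  assumes "1 \<le> l" "l < real v + 1"
  shows "3 / 20 * (sqrt l * exp l) \<le> deficit_sum l v"
proof -
  define m where "m = nat \<lfloor>l\<rfloor>"
  have m: "real m \<le> l" "l \<le> real m + 1" "m \<le> v"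
    using assms unfolding m_def by linarith+
  have "sqrt l * (3 / 20 * exp l) \<le> sqrt l * (sqrt l * weight l m)"
    using assms m by (intro mult_left_mono mode_weight_ge) auto
  also have "\<dots> = l * weight l m"
    using assms by (simp add: mult.assoc[symmetric])
  also have "\<dots> \<le> deficit_sum l m"
    using m assms by (simp add: deficit_sum_eq sum_nonneg weight_nonneg)
  also have "\<dots> \<le> deficit_sum l v"
    using assms m by (intro deficit_sum_mono) auto
  finally show ?thesis by (simp add: mult_ac)
qed

lemma sqrt_mult_top_weight_le:
  assumes "1 \<le> l" "1 \<le> v" "l \<le> real v + 1"
  shows "sqrt l * weight l v \<le> 6 * exp l"
proof -
  define J where "J = nat \<lfloor>sqrt l / 3\<rfloor>"
  have s: "1 \<le> sqrt l" using assms by simp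
  have "sqrt l * 1 \<le> sqrt l * sqrt l" using s by (intro mult_left_mono) auto
  then have sl: "sqrt l \<le> l" using assms by simp
  have J: "real J \<le> sqrt l / 3" "sqrt l / 3 \<le> real J + 1"
    using s unfolding J_def by linarith+
  have near: "j \<le> v" "weight l v / 2 \<le> weight l (v - j)" if "j \<le> J" for j
    using weight_before_top[of l v 1 j] assms J sl that by auto
  have "(sqrt l / 3) * (weight l v / 2) \<le> (real J + 1) * (weight l v / 2)"
    using J assms by (intro mult_right_mono) (auto simp: weight_nonneg)
  also have "\<dots> = (\<Sum>j\<le>J. weight l v / 2)" by simp
  also have "\<dots> \<le> (\<Sum>j\<le>J. weight l (v - j))"
    using near by (intro sum_mono) auto
  also have "\<dots> = (\<Sum>k\<in>(\<lambda>j. v - j) ` {..J}. weight l k)"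
  proof (rule sum.reindex_cong[symmetric])
    show "inj_on (\<lambda>j. v - j) {..J}"
      by (rule inj_onI) (use near in fastforce)
  qed auto
  also have "\<dots> \<le> exp l"
    using assms by (intro sum_weight_le_exp) auto
  finally show ?thesis by simp
qed

lemma deficit_sum_le_below:
  assumes "1 \<le> l" "1 \<le> v" "l \<le> real v + 1"
  shows "deficit_sum l v \<le> (real v + 1 - l + 6 * sqrt l) * exp l"
proof -
  have "l * weight l v = sqrt l * (sqrt l * weight l v)"
    using assms by (simp add: mult.assoc[symmetric])
  also have "\<dots> \<le> sqrt l * (6 * exp l)"
    using assms by (intro mult_left_mono sqrt_mult_top_weight_le) auto
  finally have "l * weight l v \<le> sqrt l * (6 * exp l)" .
  moreover have "(real v + 1 - l) * (\<Sum>k\<le>v. weight l k) \<le> (real v + 1 - l) * exp l"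
    using assms by (intro mult_left_mono sum_weight_le_exp) auto
  ultimately show ?thesis
    by (simp add: deficit_sum_eq algebra_simps)
qed

section \<open>Mean above the cut-off\<close>

lemma deficit_sum_le_top:
  assumes "0 \<le> l" "real v \<le> l"
  shows "deficit_sum l v \<le> (real v + 1 + l) * weight l v"
proof -
  have E: "0 \<le> (\<Sum>k\<le>v. weight l k)"
    using assms by (intro sum_nonneg weight_nonneg)
  have "(\<Sum>k\<le>v. weight l k) \<le> (\<Sum>k\<le>v. weight l v)"
    using assms by (intro sum_mono weight_mono_below) auto
  then have "(\<Sum>k\<le>v. weight l k) \<le> (real v + 1) * weight l v"
    by (simp add: add.commute)
  moreover have "(real v + 1 - l) * (\<Sum>k\<le>v. weight l k) \<le> 1 * (\<Sum>k\<le>v. weight l k)"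
    using assms E by (intro mult_right_mono) auto
  ultimately show ?thesis
    by (simp add: deficit_sum_eq algebra_simps)
qed

lemma deficit_sum_le_geometric:
  assumes "real v < l"
  shows "deficit_sum l v \<le> weight l v * (l / (l - real v))\<^sup>2"
proof -
  have l: "0 < l" using assms by linarith
  define r where "r = real v / l"
  have r: "0 \<le> r" "r < 1" using assms l by (auto simp: r_def)
  have S: "(\<lambda>n. real (Suc n) * r ^ n) sums (1 / (1 - r)\<^sup>2)"
    using geometric_deriv_sums[of r] r by simp
  have "deficit_sum l v = (\<Sum>j\<le>v. (real j + 1) * weight l (v - j))"
    by (rule deficit_sum_rev)
  also have "\<dots> \<le> (\<Sum>j\<le>v. (real j + 1) * (weight l v * r ^ j))"
    unfolding r_def using l by (intro sum_mono mult_left_mono weight_down_le) auto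
  also have "\<dots> = weight l v * (\<Sum>j\<le>v. real (Suc j) * r ^ j)"
    by (simp add: sum_distrib_left mult_ac add.commute)
  also have "\<dots> \<le> weight l v * (\<Sum>j. real (Suc j) * r ^ j)"
    using l r by (intro mult_left_mono weight_nonneg sum_le_suminf sums_summable[OF S]) auto
  also have "(\<Sum>j. real (Suc j) * r ^ j) = (1 / (1 - r))\<^sup>2"
    using sums_unique[OF S] by (simp add: power_divide)
  also have "1 / (1 - r) = l / (l - real v)"
    using l assms by (simp add: r_def field_simps)
  finally show ?thesis .
qed

lemma deficit_sum_ge_top:
  assumes "1 \<le> l" "l \<le> 3 * real v" "1 \<le> A" "l \<le> real v + A"
  shows "weight l v * min l ((l / A)\<^sup>2) / 36 \<le> deficit_sum l v"
proof -
  define x where "x = min (sqrt l) (l / A) / 3"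
  define J where "J = nat \<lfloor>x\<rfloor>"
  have x: "0 \<le> x" using assms by (simp add: x_def)
  have J: "real J \<le> x" "x \<le> real J + 1"
    using x unfolding J_def by linarith+
  have near: "j \<le> v" "weight l v / 2 \<le> weight l (v - j)" if "j \<le> J" for j
    using weight_before_top[OF assms, of j] J that by (auto simp: x_def)
  have w: "0 \<le> weight l v" using assms by (simp add: weight_nonneg)
  have "min l ((l / A)\<^sup>2) = (3 * x)\<^sup>2"
  proof (cases "sqrt l \<le> l / A")
    case True
    then have "(sqrt l)\<^sup>2 \<le> (l / A)\<^sup>2" using assms by (intro power_mono) auto
    then show ?thesis using True assms by (simp add: x_def min_def)
  next
    case False
    then have "(l / A)\<^sup>2 \<le> (sqrt l)\<^sup>2" using assms by (intro power_mono) auto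
    then show ?thesis using False assms by (auto simp: x_def min_def)
  qed
  then have "weight l v * min l ((l / A)\<^sup>2) / 36 = weight l v / 2 * (x\<^sup>2 / 2)"
    by (simp add: power_mult_distrib)
  also have "\<dots> \<le> weight l v / 2 * (\<Sum>j\<le>J. real j + 1)"
  proof (intro mult_left_mono)
    have gauss: "(\<Sum>j\<le>J. real j + 1) = (real J + 1) * (real J + 2) / 2"
      by (induction J) (auto simp: field_simps)
    have "x * x \<le> (real J + 1) * (real J + 2)"
      using J x by (intro mult_mono) auto
    then show "x\<^sup>2 / 2 \<le> (\<Sum>j\<le>J. real j + 1)"
      unfolding gauss by (simp add: power2_eq_square)
  qed (use w in auto)
  also have "\<dots> = (\<Sum>j\<le>J. (real j + 1) * (weight l v / 2))"
    by (simp add: sum_distrib_left mult_ac)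
  also have "\<dots> \<le> (\<Sum>j\<le>J. (real j + 1) * weight l (v - j))"
    using near by (intro sum_mono mult_left_mono) auto
  also have "\<dots> \<le> (\<Sum>j\<le>v. (real j + 1) * weight l (v - j))"
    using near assms by (intro sum_mono2 mult_nonneg_nonneg weight_nonneg) auto
  also have "\<dots> = deficit_sum l v"
    by (rule deficit_sum_rev[symmetric])
  finally show ?thesis .
qed

section \<open>Uniform bounds in terms of the iterated logarithm\<close>

text \<open>
  Here \<open>L\<close> stands for \<open>ln (ln y)\<close>. With \<open>d = 1 / ln 4 - \<delta>\<close>, the gap \<open>v + 1 - \<lambda>\<close> is \<open>2 * L * d\<close> up to
  an error of at most \<open>1\<close>, and \<open>sqrt \<lambda>\<close> has the order of \<open>L * (1 / sqrt L)\<close> because \<open>\<delta>\<close> stays away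
  from \<open>0\<close>; this is where the constant depends on \<open>c\<close>.
\<close>

lemma deficit_sum_order_below:
  fixes c \<delta> L :: real and v :: nat
  assumes c: "0 < c" "c \<le> \<delta>" "c \<le> 1" and "\<delta> \<le> 1" "3 \<le> L" "1 \<le> 2 * c * L" "\<delta> \<le> 1 / ln 4"
    and v: "real v \<le> 2 * L / ln 4" "2 * L / ln 4 < real v + 1" "1 \<le> v"
  defines "X \<equiv> max (1 / ln 4 - \<delta>) (1 / sqrt L)"
  shows "3 / 20 * c * L * (exp (2 * \<delta> * L) * X) \<le> deficit_sum (2 * \<delta> * L) v"
    and "deficit_sum (2 * \<delta> * L) v \<le> 12 * L * (exp (2 * \<delta> * L) * X)"
proof -
  define l where "l = 2 * \<delta> * L"
  define d where "d = 1 / ln 4 - \<delta>"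
  have "2 * c * L \<le> l" unfolding l_def using c assms by (intro mult_mono) auto
  then have l1: "1 \<le> l" using assms by linarith
  have gap: "2 * L / ln 4 - l = 2 * L * d"
    by (simp add: l_def d_def algebra_simps)
  have d0: "0 \<le> d" using assms by (simp add: d_def)
  have "0 \<le> 2 * L * d" using d0 assms by simp
  then have lv: "l < real v + 1" using gap v by linarith
  have s: "1 \<le> sqrt L" "sqrt L * sqrt L = L" using assms by auto
  have LX': "L * X = max (L * d) (sqrt L)"
  proof -
    have "sqrt L = L * (1 / sqrt L)" using s by (simp add: field_simps)
    then show ?thesis
      unfolding X_def d_def using assms
      by (metis max_mult_distrib_left order_trans zero_le_numeral)
  qed
  then have LX: "L * d \<le> L * X" "sqrt L \<le> L * X" by auto
  have "c * sqrt L \<le> sqrt l"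
  proof (rule real_le_rsqrt)
    have "c * c \<le> 1 * c" using c by (intro mult_right_mono) auto
    then have "c\<^sup>2 * L \<le> 2 * c * L" using c assms by (intro mult_right_mono) (auto simp: power2_eq_square)
    also have "\<dots> \<le> l" by fact
    finally show "(c * sqrt L)\<^sup>2 \<le> l"
      using assms by (simp add: power_mult_distrib)
  qed
  then have "3 / 20 * (c * sqrt L * exp l) \<le> 3 / 20 * (sqrt l * exp l)" by simp
  also have "\<dots> \<le> deficit_sum l v"
    using l1 lv by (rule deficit_sum_ge_sqrt)
  finally have lo1: "3 / 20 * c * (sqrt L * exp l) \<le> deficit_sum l v" by (simp add: mult_ac)
  have "3 / 20 * c * (L * d) \<le> 1 * (L * d)"
    using c d0 assms by (intro mult_right_mono) auto
  also have "\<dots> \<le> real v + 1 - l" using gap v d0 \<open>0 \<le> 2 * L * d\<close> by linarith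
  finally have "3 / 20 * c * (L * d) * exp l \<le> (real v + 1 - l) * exp l"
    by (intro mult_right_mono) auto
  also have "\<dots> \<le> deficit_sum l v"
    using l1 by (intro deficit_sum_ge_mean_gap) auto
  finally have lo2: "3 / 20 * c * (L * d * exp l) \<le> deficit_sum l v" by (simp add: mult_ac)
  have "3 / 20 * c * (L * X * exp l) \<le> deficit_sum l v"
    using lo1 lo2 unfolding LX' by (auto simp: max_def)
  then show "3 / 20 * c * L * (exp (2 * \<delta> * L) * X) \<le> deficit_sum (2 * \<delta> * L) v"
    by (simp add: l_def mult_ac)
  have "l \<le> 2 * L" using assms by (simp add: l_def)
  also have "\<dots> \<le> (3 / 2 * sqrt L)\<^sup>2" using assms by (simp add: power_mult_distrib power2_eq_square)
  finally have "sqrt l \<le> 3 / 2 * sqrt L" using s by (intro real_le_lsqrt) auto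
  then have "real v + 1 - l + 6 * sqrt l \<le> 2 * (L * d) + 1 + 9 * sqrt L"
    using gap v by linarith
  also have "\<dots> \<le> 12 * (L * X)" using LX s by linarith
  finally have "(real v + 1 - l + 6 * sqrt l) * exp l \<le> 12 * (L * X) * exp l"
    by (intro mult_right_mono) auto
  moreover have "deficit_sum l v \<le> (real v + 1 - l + 6 * sqrt l) * exp l"
    using l1 v lv by (intro deficit_sum_le_below) auto
  ultimately have "deficit_sum l v \<le> 12 * (L * X) * exp l" by linarith
  then show "deficit_sum (2 * \<delta> * L) v \<le> 12 * L * (exp (2 * \<delta> * L) * X)"
    by (simp add: l_def mult_ac)
qed

text \<open>
  With \<open>q = \<delta> - 1 / ln 4\<close>, the excess \<open>\<lambda> - v\<close> lies between \<open>2 * L * q\<close> and \<open>2 * L * q + 1\<close>, so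
  \<open>(\<lambda> / (\<lambda> - v))\<^sup>2\<close> is governed by \<open>1 / q\<^sup>2 = L / (q\<^sup>2 * L)\<close>.
\<close>

lemma deficit_sum_order_above:
  fixes \<delta> L :: real and v :: nat
  assumes "\<delta> \<le> 1" "3 \<le> L" "1 / ln 4 < \<delta>"
    and v: "real v \<le> 2 * L / ln 4" "2 * L / ln 4 < real v + 1"
           "2 * L \<le> 3 * real v" "2 * real v \<le> 3 * L" "L \<le> 2 * L / ln 4"
  defines "T \<equiv> weight (2 * \<delta> * L) v * (1 / max ((\<delta> - 1 / ln 4)\<^sup>2 * L) 1)"
  shows "L / 360 * T \<le> deficit_sum (2 * \<delta> * L) v"
    and "deficit_sum (2 * \<delta> * L) v \<le> 4 * L * T"
proof -
  define l where "l = 2 * \<delta> * L"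
  define q where "q = \<delta> - 1 / ln 4"
  define M where "M = max (q\<^sup>2 * L) 1"
  have q: "0 < q" using assms by (simp add: q_def)
  have gap: "l - 2 * L / ln 4 = 2 * L * q"
    by (simp add: l_def q_def algebra_simps)
  have Lq: "0 < 2 * L * q" using q assms by simp
  have lL: "L \<le> l" "l \<le> 2 * L"
    using Lq gap v assms by (linarith, simp add: l_def)
  have ex: "2 * L * q \<le> l - real v" "l \<le> real v + (2 * L * q + 1)"
    using gap v by linarith+
  have w: "0 \<le> weight l v" using lL assms by (simp add: weight_nonneg)
  have M: "1 \<le> M" "q\<^sup>2 * L \<le> M" by (auto simp: M_def)
  have T: "T = weight l v / M" by (simp add: T_def M_def q_def l_def)

  define A where "A = 2 * L * q + 1"
  have A: "1 \<le> A" using Lq by (simp add: A_def)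
  have "L / (10 * M) \<le> min l ((l / A)\<^sup>2)"
  proof (rule min.boundedI)
    have "L * 1 \<le> L * (10 * M)" using M assms by (intro mult_left_mono) auto
    then have "L / (10 * M) \<le> L" using M by (simp add: field_simps)
    then show "L / (10 * M) \<le> l" using lL by simp
    \<comment> \<open>This is \<open>(x + 1)\<^sup>2 \<le> 2 * x\<^sup>2 + 2\<close> for \<open>x = 2 * L * q\<close>.\<close>
    have "0 \<le> (2 * L * q - 1)\<^sup>2" by simp
    then have "A\<^sup>2 \<le> 8 * L * (q\<^sup>2 * L) + 2"
      by (simp add: A_def power2_eq_square algebra_simps)
    also have "\<dots> \<le> 8 * L * M + 2 * (L * M)"
    proof (rule add_mono)
      show "8 * L * (q\<^sup>2 * L) \<le> 8 * L * M" using M assms by (intro mult_left_mono) auto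
      have "1 * 1 \<le> L * M" using M assms by (intro mult_mono) auto
      then show "2 \<le> 2 * (L * M)" by simp
    qed
    finally have A2: "A\<^sup>2 \<le> 10 * (L * M)" by simp
    have "L / (10 * M) = L\<^sup>2 / (10 * (L * M))"
      using assms by (simp add: power2_eq_square)
    also have "\<dots> \<le> l\<^sup>2 / A\<^sup>2"
      using A2 A lL assms by (intro frac_le power_mono) auto
    finally show "L / (10 * M) \<le> (l / A)\<^sup>2" by (simp add: power_divide)
  qed
  then have "weight l v * (L / (10 * M)) / 36 \<le> weight l v * min l ((l / A)\<^sup>2) / 36"
    using w by (intro divide_right_mono mult_left_mono) auto
  also have "\<dots> \<le> deficit_sum l v"
    using ex lL v A assms by (intro deficit_sum_ge_top) (auto simp: A_def)
  finally show "L / 360 * T \<le> deficit_sum (2 * \<delta> * L) v"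
    by (simp add: T l_def mult_ac)

  have "deficit_sum l v * M \<le> 4 * L * weight l v"
  proof (cases "q\<^sup>2 * L \<le> 1")
    case True
    have "deficit_sum l v \<le> (real v + 1 + l) * weight l v"
      using ex Lq lL assms by (intro deficit_sum_le_top) auto
    also have "\<dots> \<le> 4 * L * weight l v"
    proof (intro mult_right_mono w)
      show "real v + 1 + l \<le> 4 * L" using v lL assms by linarith
    qed
    finally show ?thesis using True by (simp add: M_def max_def)
  next
    case False
    have "deficit_sum l v \<le> weight l v * (l / (l - real v))\<^sup>2"
      using ex Lq by (intro deficit_sum_le_geometric) auto
    also have "\<dots> \<le> weight l v * (1 / q)\<^sup>2"
    proof (intro mult_left_mono power_mono w)
      have "l / (l - real v) \<le> (2 * L) / (2 * L * q)"
        using ex Lq lL assms by (intro frac_le) auto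
      then show "l / (l - real v) \<le> 1 / q" using assms by simp
    qed (use ex Lq lL assms in auto)
    finally have "deficit_sum l v * (q\<^sup>2 * L) \<le> weight l v * (1 / q)\<^sup>2 * (q\<^sup>2 * L)"
      using assms by (intro mult_right_mono) auto
    also have "\<dots> = L * weight l v" using q by (simp add: field_simps)
    also have "\<dots> \<le> 4 * L * weight l v" using w assms by simp
    finally show ?thesis using False by (simp add: M_def max_def)
  qed
  then show "deficit_sum (2 * \<delta> * L) v \<le> 4 * L * T"
    using M by (simp add: T l_def field_simps)
qed

text \<open>
  Since \<open>v\<close> has the order of \<open>L\<close>, dividing by \<open>v\<close> only changes the constants.
\<close>

lemma weighted_sum_order:
  fixes c \<delta> y :: real
  assumes c: "0 < c" "c \<le> 1" and \<delta>: "c \<le> \<delta>" "\<delta> \<le> 1"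
    and L: "3 \<le> ln (ln y)" "1 \<le> 2 * c * ln (ln y)"
  shows "c / 1620 * size_bound \<delta> y \<le> weighted_sum \<delta> y"
    and "weighted_sum \<delta> y \<le> 18 * size_bound \<delta> y"
proof -
  define L where "L = ln (ln y)"
  define l where "l = 2 * \<delta> * L"
  define v where "v = vv y"
  define G where "G = (\<Sum>k=1..v. (real v - real k + 1) * weight l k)"
  have L3: "3 \<le> L" and cL: "1 \<le> 2 * c * L" using L by (simp_all add: L_def)
  have "ln (4 :: real) = ln (2 ^ 2)" by simp
  also have "\<dots> = 2 * ln 2" by (subst ln_realpow) auto
  finally have ln4: "ln (4 :: real) = 2 * ln 2" .
  then have L_eq: "2 * L / ln 4 = L / ln 2" by simp
  have ln2: "2 / 3 \<le> ln (2 :: real)" "ln (2 :: real) \<le> 1"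
    using ln2_ge_two_thirds ln_2_less_1 by auto
  have L_ge: "L \<le> L / ln 2" and L_le: "L / ln 2 \<le> 3 / 2 * L"
  proof -
    have "L * ln 2 \<le> L * 1" using ln2 L3 by (intro mult_left_mono) auto
    then show "L \<le> L / ln 2" using ln2 by (simp add: field_simps)
    have "L * (2 / 3) \<le> L * ln 2" using ln2 L3 by (intro mult_left_mono) auto
    then show "L / ln 2 \<le> 3 / 2 * L" using ln2 by (simp add: field_simps)
  qed
  have v_eq: "v = nat \<lfloor>L / ln 2\<rfloor>" by (simp add: v_def vv_def L_def)
  have v: "real v \<le> L / ln 2" "L / ln 2 < real v + 1"
    unfolding v_eq using L_ge L3 by linarith+
  have vL: "2 * L \<le> 3 * real v" "2 * real v \<le> 3 * L" "1 \<le> v"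
    using v L_ge L_le L3 by linarith+
  have "2 * c * L \<le> l" unfolding l_def using c \<delta> L3 by (intro mult_mono) auto
  then have l1: "1 \<le> l" using cL by linarith
  have lam: "lam \<delta> y = l" by (simp add: lam_def l_def L_def)
  have "weighted_sum \<delta> y = G / real v"
    unfolding weighted_sum_def G_def lam v_def[symmetric] weight_def
    by (simp add: sum_divide_distrib mult_ac)
  then have WG: "weighted_sum \<delta> y * real v = G" using vL by simp
  have G: "G \<le> deficit_sum l v" "deficit_sum l v \<le> 3 * G"
    unfolding G_def using deficit_sum_from_1[OF l1 vL(3)] by auto
  define S where "S = size_bound \<delta> y"
  have S0: "0 \<le> S"
    unfolding S_def size_bound_def lam using l1 L3 by (auto simp: L_def le_max_iff_disj)
  have lo: "L * (c / 360 * S) \<le> deficit_sum l v" and up: "deficit_sum l v \<le> L * (12 * S)"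
  proof -
    have "L * (c / 360 * S) \<le> deficit_sum l v \<and> deficit_sum l v \<le> L * (12 * S)"
    proof (cases "\<delta> \<le> 1 / ln 4")
      case True
      have S: "S = exp l * max (1 / ln 4 - \<delta>) (1 / sqrt L)"
        using True by (simp add: S_def size_bound_def lam L_def)
      have "3 / 20 * c * L * S \<le> deficit_sum l v \<and> deficit_sum l v \<le> 12 * L * S"
        unfolding S l_def using c \<delta> L3 cL True v vL L_eq
        by (intro conjI deficit_sum_order_below) auto
      moreover have "1 / 360 * (c * L * S) \<le> 3 / 20 * (c * L * S)"
        using c L3 S0 by (intro mult_right_mono) auto
      ultimately show ?thesis by (simp add: mult_ac)
    next
      case False
      have S: "S = weight l v * (1 / max ((\<delta> - 1 / ln 4)\<^sup>2 * L) 1)"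
        using False by (simp add: S_def size_bound_def lam L_def weight_def v_def)
      have "L / 360 * S \<le> deficit_sum l v \<and> deficit_sum l v \<le> 4 * L * S"
        unfolding S l_def using \<delta> L3 False v vL L_eq L_ge
        by (intro conjI deficit_sum_order_above) auto
      moreover have "c * (L * S) \<le> 1 * (L * S)" "4 * (L * S) \<le> 12 * (L * S)"
        using c L3 S0 by (intro mult_right_mono mult_nonneg_nonneg; simp)+
      ultimately show ?thesis by (simp add: mult_ac)
    qed
    then show "L * (c / 360 * S) \<le> deficit_sum l v" "deficit_sum l v \<le> L * (12 * S)" by auto
  qed
  have "real v * (c / 360 * S) \<le> 3 / 2 * L * (c / 360 * S)"
    using vL c S0 by (intro mult_right_mono) auto
  also have "\<dots> = 3 / 2 * (L * (c / 360 * S))" by simp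
  also have "\<dots> \<le> 9 / 2 * G" using lo G by linarith
  finally have "real v * (c / 1620 * S) \<le> real v * weighted_sum \<delta> y"
    unfolding WG[symmetric] by (simp add: mult_ac)
  then show "c / 1620 * size_bound \<delta> y \<le> weighted_sum \<delta> y"
    using vL by (simp add: S_def)
  have "G \<le> 3 / 2 * real v * (12 * S)"
    using G up vL S0 by (intro order_trans[OF _ mult_right_mono[of L "3 / 2 * real v"]]) auto
  then have "real v * weighted_sum \<delta> y \<le> real v * (18 * S)"
    unfolding WG[symmetric] by (simp add: mult_ac)
  then show "weighted_sum \<delta> y \<le> 18 * size_bound \<delta> y"
    using vL by (simp add: S_def)
qed

theorem proposition1p5:
  fixes c :: real
  assumes "0 < c" and "c \<le> 1 / 10"
  shows "\<exists>C1 C2 :: real. C1 > 0 \<and> C2 > 0 \<and>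
    (\<forall>\<kappa>::real. \<kappa> \<ge> 2 \<longrightarrow>
      (\<exists>y0::real. \<forall>y>y0. \<forall>\<delta>\<in>{c..1}.
         C1 * size_bound \<delta> y \<le> weighted_sum \<delta> y \<and>
         weighted_sum \<delta> y \<le> C2 * size_bound \<delta> y))"
proof -
  \<comment> \<open>The second bound makes \<open>\<lambda> \<ge> 1\<close> for every \<open>\<delta> \<ge> c\<close>.\<close>
  define L0 where "L0 = max 3 (1 / (2 * c))"
  have "c / 1620 * size_bound \<delta> y \<le> weighted_sum \<delta> y \<and>
        weighted_sum \<delta> y \<le> 18 * size_bound \<delta> y"
    if y: "y > exp (exp L0)" and \<delta>: "\<delta> \<in> {c..1}" for y \<delta>
  proof -
    have y0: "0 < y" using y exp_gt_zero[of "exp L0"] by linarith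
    then have "exp L0 < ln y" using y by (metis exp_ln exp_less_cancel_iff)
    moreover from this have "0 < ln y" using exp_gt_zero[of L0] by linarith
    ultimately have "L0 \<le> ln (ln y)" by (simp add: ln_ge_iff)
    then have "3 \<le> ln (ln y)" and "1 / (2 * c) \<le> ln (ln y)" by (auto simp: L0_def)
    moreover from this have "1 \<le> 2 * c * ln (ln y)"
      using assms by (simp add: field_simps)
    ultimately show ?thesis
      using weighted_sum_order[of c \<delta> y] assms \<delta> by auto
  qed
  moreover have "0 < c / 1620" "0 < (18 :: real)"
    using assms by auto
  ultimately show ?thesis by blast
qed

end
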